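(* Let $M=2^a$ for an integer $a\geq 1$. For a finite group $G$, let $\mu(x^M,G)=\dfrac{|\{g^M : g\in G\}|}{|G|}$, and let $\mathrm{R}(x^M)=\{\mu(x^M,G) : G \text{ is a finite group}\}\subseteq[0,1]$. Then $\overline{\mathrm{R}(x^M)}=[0,1]$.
   Context: The number $\mu(x^M,G)$ is called the image ratio of the power map $G\to G$, $g\mapsto g^M$, on the finite group $G$. The overline denotes topological closure in $[0,1]$ with its usual topology. *)

theory Defs
  imports "HOL-Analysis.Analysis" "HOL-Algebra.Group"
begin

definition image_ratio :: "nat \<Rightarrow> ('a, 'b) monoid_scheme \<Rightarrow> real" where
  "image_ratio M G = real (card {g [^]\<^bsub>G\<^esub> M | g. g \<in> carrier G}) / real (card (carrier G))"

(* HOL cannot collect values over groups of all types in one set, so groups are taken with carrier a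
   set of natural numbers. Every finite group has an isomorphic copy of this form, and no value is
   lost: see image_ratio_in_image_ratios. *)
definition image_ratios :: "nat \<Rightarrow> real set" where
  "image_ratios M = {image_ratio M G | G :: nat monoid. group G \<and> finite (carrier G)}"

lemma image_ratio_in_image_ratios:
  fixes G :: "('a, 'b) monoid_scheme"
  assumes "group G" and fin: "finite (carrier G)"
  shows "image_ratio M G \<in> image_ratios M"
proof -
  interpret G: group G by fact
  obtain f :: "'a \<Rightarrow> nat" where f: "inj_on f (carrier G)"
    using finite_imp_inj_to_nat_seg[OF fin] by blast
  define h where "h = inv_into (carrier G) f"
  have hf: "h (f x) = x" if "x \<in> carrier G" for x
    using f that by (simp add: h_def)
  define H :: "nat monoid" where
    "H = \<lparr>carrier = f ` carrier G, mult = (\<lambda>x y. f (h x \<otimes>\<^bsub>G\<^esub> h y)), one = f \<one>\<^bsub>G\<^esub>\<rparr>"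
  have H: "group H"
  proof (rule groupI)
    fix x assume "x \<in> carrier H"
    then obtain a where a: "a \<in> carrier G" "x = f a" by (auto simp: H_def)
    then show "\<exists>y\<in>carrier H. y \<otimes>\<^bsub>H\<^esub> x = \<one>\<^bsub>H\<^esub>"
      by (intro bexI[of _ "f (inv\<^bsub>G\<^esub> a)"]) (auto simp: H_def hf)
  qed (auto simp: H_def hf G.m_assoc)
  interpret H: group H by (fact H)
  have pow: "f a [^]\<^bsub>H\<^esub> n = f (a [^]\<^bsub>G\<^esub> n)" if "a \<in> carrier G" for a and n :: nat
  proof (induction n)
    case 0
    then show ?case by (simp add: H_def)
  next
    case (Suc n)
    have "f a [^]\<^bsub>H\<^esub> Suc n = f (a [^]\<^bsub>G\<^esub> n) \<otimes>\<^bsub>H\<^esub> f a"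
      by (simp add: Suc)
    also have "\<dots> = f (a [^]\<^bsub>G\<^esub> Suc n)"
      using that by (simp add: H_def hf)
    finally show ?case .
  qed
  have "{x [^]\<^bsub>H\<^esub> M | x. x \<in> carrier H} = f ` {x [^]\<^bsub>G\<^esub> M | x. x \<in> carrier G}"
  proof -
    have "carrier H = f ` carrier G" by (simp add: H_def)
    then show ?thesis using pow by (auto simp: image_iff) metis+
  qed
  moreover have "inj_on f {x [^]\<^bsub>G\<^esub> M | x. x \<in> carrier G}"
    by (rule inj_on_subset[OF f]) auto
  ultimately have "image_ratio M H = image_ratio M G"
    by (simp add: image_ratio_def card_image f) (simp add: H_def card_image f)
  moreover have "finite (carrier H)" using fin by (simp add: H_def)
  ultimately show ?thesis using H unfolding image_ratios_def by (smt (verit) mem_Collect_eq)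
qed

lemma image_ratios_subset: "image_ratios M \<subseteq> {0..1}"
proof
  fix r assume "r \<in> image_ratios M"
  then obtain G :: "nat monoid" where G: "group G" "finite (carrier G)" "r = image_ratio M G"
    by (auto simp: image_ratios_def)
  interpret G: group G by fact
  have "card {g [^]\<^bsub>G\<^esub> M | g. g \<in> carrier G} \<le> card (carrier G)"
    by (rule card_mono) (use G in auto)
  then show "r \<in> {0..1}" using G by (auto simp: image_ratio_def divide_le_eq_1)
qed

end

theory Submission
  imports Defs "HOL-Number_Theory.Cong"
begin

text \<open>
  Image ratios are multiplicative over direct products, so if \<open>r\<close> is a ratio then so is every power
  \<open>r ^ k\<close>. When \<open>r < 1\<close> is close to \<open>1\<close>, consecutive powers of \<open>r\<close> differ by at most \<open>1 - r\<close> and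
  tend to \<open>0\<close>, hence leave no large gap in \<open>[0, 1]\<close>. It therefore suffices to find ratios below \<open>1\<close>
  but arbitrarily close to it.

  For a power of \<open>2\<close>, elements of odd order are always \<open>M\<close>-th powers, whereas an involution is not
  one as long as no element has order \<open>4\<close>. So a group is needed in which almost every element has
  odd order, a few are involutions, and nothing else occurs. A Frobenius group \<open>V \<rtimes> C\<close> with \<open>V\<close> an
  elementary abelian \<open>2\<close>-group and \<open>C\<close> cyclic of large odd prime order \<open>p\<close> has this shape: the
  nontrivial elements of \<open>V\<close> are involutions, and everything outside \<open>V\<close> has order \<open>p\<close>. Its ratio
  is \<open>1 - (|V| - 1) / (p |V|)\<close>, which lies in \<open>[1 - 1/p, 1)\<close>. For \<open>V\<close> one can take the vectors over
  the field with two elements whose \<open>p\<close> coordinates sum to zero, permuted cyclically by \<open>C\<close>: a vector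
  fixed by a nontrivial shift is constant, and the constant vector \<open>1\<close> has odd weight \<open>p\<close>.
\<close>

section \<open>Direct products\<close>

lemma DirProd_nat_pow:
  "(x, y) [^]\<^bsub>G \<times>\<times> H\<^esub> (n :: nat) = (x [^]\<^bsub>G\<^esub> n, y [^]\<^bsub>H\<^esub> n)"
  by (induction n) (simp_all add: nat_pow_def DirProd_def)

lemma image_ratio_DirProd:
  "image_ratio M (G \<times>\<times> H) = image_ratio M G * image_ratio M H"
proof -
  have "{z [^]\<^bsub>G \<times>\<times> H\<^esub> M | z. z \<in> carrier (G \<times>\<times> H)}
      = {x [^]\<^bsub>G\<^esub> M | x. x \<in> carrier G} \<times> {y [^]\<^bsub>H\<^esub> M | y. y \<in> carrier H}"
    by (force simp: DirProd_nat_pow)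
  then show ?thesis
    by (simp add: image_ratio_def card_cartesian_product)
qed

lemma image_ratios_mult:
  assumes "r \<in> image_ratios M" and "s \<in> image_ratios M"
  shows "r * s \<in> image_ratios M"
proof -
  obtain G H :: "nat monoid" where G: "group G" "finite (carrier G)" "r = image_ratio M G"
    and H: "group H" "finite (carrier H)" "s = image_ratio M H"
    using assms by (auto simp: image_ratios_def)
  have "image_ratio M (G \<times>\<times> H) \<in> image_ratios M"
    using G H by (intro image_ratio_in_image_ratios DirProd_group) simp_all
  then show ?thesis
    using G H by (simp add: image_ratio_DirProd)
qed

lemma one_in_image_ratios: "1 \<in> image_ratios M"
proof -
  define G :: "unit monoid" where "G = \<lparr>carrier = UNIV, mult = (\<lambda>_ _. ()), one = ()\<rparr>"
  have "group G"
    by (rule groupI) (simp_all add: G_def)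
  then have "image_ratio M G \<in> image_ratios M"
    by (rule image_ratio_in_image_ratios) simp
  moreover have "{g [^]\<^bsub>G\<^esub> M | g. g \<in> carrier G} = {()}"
    by (auto simp: G_def)
  ultimately show ?thesis
    by (simp add: image_ratio_def) (simp add: G_def)
qed

lemma image_ratios_power: "r \<in> image_ratios M \<Longrightarrow> r ^ k \<in> image_ratios M"
  by (induction k) (simp_all add: one_in_image_ratios image_ratios_mult)

section \<open>Groups in which every element is an involution or has odd order\<close>

lemma (in group) nat_pow_cong:
  fixes m n p :: nat
  assumes x: "x \<in> carrier G" and p: "x [^] p = \<one>" and mn: "[m = n] (mod p)"
  shows "x [^] m = x [^] n"
proof -
  have reduce: "x [^] k = x [^] (k mod p)" for k :: nat
  proof -
    have "x [^] k = x [^] (p * (k div p) + k mod p)"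
      by simp
    also have "\<dots> = (x [^] p) [^] (k div p) \<otimes> x [^] (k mod p)"
      using x by (simp only: nat_pow_mult nat_pow_pow)
    finally show ?thesis
      using x p by simp
  qed
  show ?thesis
    using reduce[of m] reduce[of n] mn by (simp add: cong_def)
qed

text \<open>
  An exponent coprime to \<open>p\<close> is invertible modulo \<open>p\<close>, so raising to it is undone by a further power.
\<close>

lemma (in group) nat_pow_coprime_root:
  fixes m p :: nat
  assumes x: "x \<in> carrier G" and p: "x [^] p = \<one>" and "coprime m p"
  obtains u :: nat where "x = (x [^] m) [^] u"
proof -
  obtain u where "[m * u = Suc 0] (mod p)"
    using cong_solve_coprime_nat assms(3) by blast
  from nat_pow_cong[OF x p this] have "x = (x [^] m) [^] u"
    using x by (simp add: nat_pow_pow)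
  then show ?thesis
    by (rule that)
qed

text \<open>
  Every element order divides \<open>2\<close> or the odd number \<open>p\<close>, so no element has order \<open>4\<close>; this is what
  keeps the involutions out of the image.
\<close>

lemma (in group) power_image_eq_odd_part:
  fixes p a :: nat
  assumes "odd p" and "a \<ge> 1"
    and orders: "\<And>x. x \<in> carrier G \<Longrightarrow> x [^] (2::nat) = \<one> \<or> x [^] p = \<one>"
  shows "{g [^] (2 ^ a :: nat) | g. g \<in> carrier G}
       = insert \<one> (carrier G - {x \<in> carrier G. x [^] (2::nat) = \<one>})"
    (is "?L = ?R")
proof
  have M: "(2 ^ a :: nat) = 2 * 2 ^ (a - 1)"
    using assms(2) by (cases a) simp_all
  show "?L \<subseteq> ?R"
  proof (rule subsetI, rule ccontr)
    fix y assume "y \<in> ?L" "y \<notin> ?R"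
    then obtain g where g: "g \<in> carrier G" and ne: "g [^] (2 ^ a :: nat) \<noteq> \<one>"
      and sq: "(g [^] (2 ^ a :: nat)) [^] (2::nat) = \<one>"
      by auto
    have "g [^] (2::nat) \<noteq> \<one>"
      using ne g by (auto simp: M simp flip: nat_pow_pow)
    then have "g [^] p = \<one>"
      using orders g by blast
    then obtain u :: nat where "g = (g [^] (2 ^ a * 2 :: nat)) [^] u"
      using nat_pow_coprime_root[of g p "2 ^ a * 2"] g assms(1) by auto
    moreover have "g [^] (2 ^ a * 2 :: nat) = \<one>"
      using sq g by (simp add: nat_pow_pow)
    ultimately have "g = \<one>"
      by simp
    then show False
      using ne by simp
  qed
  show "?R \<subseteq> ?L"
  proof
    fix x assume "x \<in> ?R"
    then consider "x = \<one>" | "x \<in> carrier G" "x [^] p = \<one>"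
      using orders by blast
    then show "x \<in> ?L"
    proof cases
      case 1
      then show ?thesis
        by (auto intro!: exI[of _ \<one>])
    next
      case 2
      then obtain u :: nat where "x = (x [^] (2 ^ a :: nat)) [^] u"
        using nat_pow_coprime_root[of x p "2 ^ a"] assms(1) by auto
      then have "x = (x [^] u) [^] (2 ^ a :: nat)"
        using 2 by (simp add: nat_pow_pow mult.commute)
      then show ?thesis
        using 2 by blast
    qed
  qed
qed

section \<open>Even-weight vectors with cyclic shifts\<close>

text \<open>
  A vector over the field with two elements, with coordinates indexed by the residues modulo \<open>p\<close>, is
  encoded by its support. Addition is then symmetric difference, and coordinate sum zero means
  even cardinality. Shifts are preimages rather than images so that they commute with all set
  operations without any injectivity argument.
\<close>

definition shift :: "nat \<Rightarrow> nat \<Rightarrow> nat set \<Rightarrow> nat set" where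
  "shift p c S = {i. i < p \<and> (i + c) mod p \<in> S}"

definition even_sets :: "nat \<Rightarrow> nat set set" where
  "even_sets p = {S. S \<subseteq> {..<p} \<and> even (card S)}"

definition even_shift_group :: "nat \<Rightarrow> (nat set \<times> nat) monoid" where
  "even_shift_group p = \<lparr>carrier = even_sets p \<times> {..<p},
     mult = (\<lambda>(S, c) (T, d). (sym_diff S (shift p c T), (c + d) mod p)),
     one = ({}, 0)\<rparr>"

lemma shift_sym_diff: "shift p c (sym_diff S T) = sym_diff (shift p c S) (shift p c T)"
  by (auto simp: shift_def)

lemma shift_shift: "shift p c (shift p d S) = shift p ((c + d) mod p) S"
  by (auto simp: shift_def mod_simps ac_simps)

lemma shift_0: "S \<subseteq> {..<p} \<Longrightarrow> shift p 0 S = S"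
  by (auto simp: shift_def)

lemma even_card_sym_diff:
  assumes "finite S" and "finite T" and "even (card S)" and "even (card T)"
  shows "even (card (sym_diff S T))"
proof -
  have "card S = card (S - T) + card (S \<inter> T)"
    using assms(1) card_Int_Diff[of S T] by simp
  moreover have "card T = card (T - S) + card (S \<inter> T)"
    using assms(2) card_Int_Diff[of T S] by (simp add: Int_commute)
  moreover have "card (sym_diff S T) = card (S - T) + card (T - S)"
    using assms(1,2) by (intro card_Un_disjoint) auto
  ultimately show ?thesis
    using assms(3,4) by presburger
qed

lemma sym_diff_even_sets:
  assumes "S \<in> even_sets p" and "T \<in> even_sets p"
  shows "sym_diff S T \<in> even_sets p"
proof -
  have "finite S" "finite T"
    using assms by (auto simp: even_sets_def intro: finite_subset)
  then show ?thesis
    using assms even_card_sym_diff[of S T] by (auto simp: even_sets_def)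
qed

lemma shift_even_sets:
  assumes S: "S \<in> even_sets p" and c: "c < p"
  shows "shift p c S \<in> even_sets p"
proof -
  have unshift: "((i + c) mod p + (p - c)) mod p = i" "((i + (p - c)) mod p + c) mod p = i" if "i < p" for i
    using c that unfolding mod_add_left_eq by simp_all
  have "bij_betw (\<lambda>i. (i + c) mod p) (shift p c S) S"
  proof (rule bij_betw_byWitness[where f' = "\<lambda>i. (i + (p - c)) mod p"])
    show "\<forall>i\<in>shift p c S. ((i + c) mod p + (p - c)) mod p = i"
      using unshift by (simp add: shift_def)
    show "\<forall>i\<in>S. ((i + (p - c)) mod p + c) mod p = i"
      using unshift S by (auto simp: even_sets_def)
    show "(\<lambda>i. (i + c) mod p) ` shift p c S \<subseteq> S"
      by (auto simp: shift_def)
    show "(\<lambda>i. (i + (p - c)) mod p) ` S \<subseteq> shift p c S"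
      using unshift c S by (auto simp: shift_def even_sets_def)
  qed
  then have "card (shift p c S) = card S"
    by (rule bij_betw_same_card)
  then show ?thesis
    using S by (auto simp: even_sets_def shift_def)
qed

lemma even_shift_group_simps:
  "carrier (even_shift_group p) = even_sets p \<times> {..<p}"
  "(S, c) \<otimes>\<^bsub>even_shift_group p\<^esub> (T, d) = (sym_diff S (shift p c T), (c + d) mod p)"
  "\<one>\<^bsub>even_shift_group p\<^esub> = ({}, 0)"
  by (simp_all add: even_shift_group_def)

lemma group_even_shift_group:
  assumes "p > 0"
  shows "group (even_shift_group p)"
proof (rule groupI)
  fix x y assume "x \<in> carrier (even_shift_group p)" "y \<in> carrier (even_shift_group p)"
  then show "x \<otimes>\<^bsub>even_shift_group p\<^esub> y \<in> carrier (even_shift_group p)"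
    using assms
    by (cases x; cases y) (simp add: even_shift_group_simps sym_diff_even_sets shift_even_sets)
next
  show "\<one>\<^bsub>even_shift_group p\<^esub> \<in> carrier (even_shift_group p)"
    using assms by (simp add: even_shift_group_simps even_sets_def)
next
  fix x y z :: "nat set \<times> nat"
  obtain S c T d U e where "x = (S, c)" "y = (T, d)" "z = (U, e)"
    by (metis surj_pair)
  moreover have "sym_diff (sym_diff S A) B = sym_diff S (sym_diff A B)" for A B
    by blast
  ultimately show "x \<otimes>\<^bsub>even_shift_group p\<^esub> y \<otimes>\<^bsub>even_shift_group p\<^esub> z
      = x \<otimes>\<^bsub>even_shift_group p\<^esub> (y \<otimes>\<^bsub>even_shift_group p\<^esub> z)"
    by (simp only: even_shift_group_simps shift_sym_diff shift_shift) (simp add: mod_simps ac_simps)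
next
  fix x assume "x \<in> carrier (even_shift_group p)"
  then show "\<one>\<^bsub>even_shift_group p\<^esub> \<otimes>\<^bsub>even_shift_group p\<^esub> x = x"
    by (cases x) (auto simp: even_shift_group_simps even_sets_def shift_0)
next
  fix x assume "x \<in> carrier (even_shift_group p)"
  then obtain S c where x: "x = (S, c)" "S \<in> even_sets p" "c < p"
    by (auto simp: even_shift_group_simps)
  let ?d = "(p - c) mod p"
  have "?d < p"
    using assms by simp
  then have "(shift p ?d S, ?d) \<in> carrier (even_shift_group p)"
    using x by (simp add: even_shift_group_simps shift_even_sets)
  moreover have "(shift p ?d S, ?d) \<otimes>\<^bsub>even_shift_group p\<^esub> x = \<one>\<^bsub>even_shift_group p\<^esub>"
    using x by (simp add: even_shift_group_simps mod_simps)
  ultimately show "\<exists>y\<in>carrier (even_shift_group p).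
      y \<otimes>\<^bsub>even_shift_group p\<^esub> x = \<one>\<^bsub>even_shift_group p\<^esub>"
    by blast
qed

lemma finite_even_sets: "finite (even_sets p)"
  by (rule finite_subset[of _ "Pow {..<p}"]) (auto simp: even_sets_def)

text \<open>
  A nontrivial shift generates all rotations since \<open>p\<close> is prime, so a nonempty invariant set is
  everything; but \<open>p\<close> is odd.
\<close>

lemma shift_fixed_point_free:
  assumes p: "prime p" "odd p" and W: "W \<in> even_sets p"
    and c: "0 < c" "c < p" and fixed: "shift p c W = W"
  shows "W = {}"
proof (rule ccontr)
  assume "W \<noteq> {}"
  then obtain i where i: "i \<in> W" "i < p"
    using W by (auto simp: even_sets_def)
  have step: "(k + c) mod p \<in> W" if "k \<in> W" for k
    using that fixed by (auto simp: shift_def)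
  have orbit: "(i + n * c) mod p \<in> W" for n
  proof (induction n)
    case 0
    then show ?case
      using i by simp
  next
    case (Suc n)
    from step[OF this] show ?case
      by (simp add: mod_simps ac_simps)
  qed
  have "coprime c p"
    using p(1) c by (metis coprime_commute nat_dvd_not_less prime_imp_coprime)
  then obtain u where u: "[c * u = Suc 0] (mod p)"
    using cong_solve_coprime_nat by blast
  have "j \<in> W" if "j < p" for j
  proof -
    have "[i + (u * (j + p - i)) * c = i + (j + p - i)] (mod p)"
      using cong_add[OF cong_refl[of i] cong_mult[OF u cong_refl[of "j + p - i"]]]
      by (simp add: ac_simps)
    also have "i + (j + p - i) = j + p"
      using i by simp
    finally have "(i + (u * (j + p - i)) * c) mod p = j"
      using that by (simp add: cong_def)
    then show ?thesis
      using orbit by metis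
  qed
  then have "W = {..<p}"
    using W by (auto simp: even_sets_def)
  then show False
    using W p(2) by (simp add: even_sets_def)
qed

text \<open>
  For an element \<open>x\<close> outside the vectors, \<open>x ^ p\<close> is a vector that commutes with \<open>x\<close>, that is, one
  fixed by a nontrivial shift. Hence \<open>x ^ p = 1\<close> without computing the power.
\<close>

lemma even_shift_group_orders:
  assumes p: "prime p" "odd p"
    and S: "S \<in> even_sets p" and c: "0 < c" "c < p"
  shows "(S, c) [^]\<^bsub>even_shift_group p\<^esub> p = \<one>\<^bsub>even_shift_group p\<^esub>"
proof -
  let ?G = "even_shift_group p"
  interpret G: group ?G
    using group_even_shift_group p(1) prime_gt_0_nat by blast
  have x: "(S, c) \<in> carrier ?G"
    using S c by (simp add: even_shift_group_simps)
  have snd_pow: "snd ((S, c) [^]\<^bsub>?G\<^esub> n) = (n * c) mod p" for n :: nat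
  proof (induction n)
    case 0
    then show ?case
      by (simp add: even_shift_group_simps)
  next
    case (Suc n)
    then show ?case
      by (cases "(S, c) [^]\<^bsub>?G\<^esub> n") (simp add: even_shift_group_simps mod_simps ac_simps)
  qed
  obtain W where W: "(S, c) [^]\<^bsub>?G\<^esub> p = (W, 0)"
    using snd_pow[of p] by (metis mod_mult_self1_is_0 prod.collapse)
  then have "(W, 0) \<in> carrier ?G"
    using G.nat_pow_closed[OF x, of p] by simp
  then have WE: "W \<in> even_sets p"
    by (simp add: even_shift_group_simps)
  have "(S, c) \<otimes>\<^bsub>?G\<^esub> (W, 0) = (W, 0) \<otimes>\<^bsub>?G\<^esub> (S, c)"
    using G.nat_pow_Suc2[OF x, of p] W by simp
  then have "sym_diff S (shift p c W) = sym_diff W S"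
    using S by (simp add: even_shift_group_simps shift_0 even_sets_def)
  then have "shift p c W = W"
    by blast
  then have "W = {}"
    using shift_fixed_point_free p WE c by blast
  then show ?thesis
    using W by (simp add: even_shift_group_simps)
qed

lemma even_shift_group_square:
  assumes "S \<in> even_sets p" and "c < p"
  shows "(S, c) [^]\<^bsub>even_shift_group p\<^esub> (2::nat) = (sym_diff S (shift p c S), (c + c) mod p)"
proof -
  interpret G: group "even_shift_group p"
    using assms by (intro group_even_shift_group) simp
  have "(S, c) \<in> carrier (even_shift_group p)"
    using assms by (simp add: even_shift_group_simps)
  then show ?thesis
    by (simp add: numeral_2_eq_2) (simp add: even_shift_group_simps)
qed

lemma image_ratio_even_shift_group:
  assumes p: "prime p" "odd p" and a: "a \<ge> 1"
  shows "image_ratio (2 ^ a) (even_shift_group p)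
       = 1 - (1 - 1 / real (card (even_sets p))) / real p"
proof -
  let ?G = "even_shift_group p" and ?N = "card (even_sets p)"
  have p0: "p > 0"
    using p(1) prime_gt_0_nat by blast
  interpret G: group ?G
    using p0 by (rule group_even_shift_group)
  have involutions: "{x \<in> carrier ?G. x [^]\<^bsub>?G\<^esub> (2::nat) = \<one>\<^bsub>?G\<^esub>} = even_sets p \<times> {0}"
  proof -
    have "(S, c) [^]\<^bsub>?G\<^esub> (2::nat) = \<one>\<^bsub>?G\<^esub> \<longleftrightarrow> c = 0"
      if S: "S \<in> even_sets p" and c: "c < p" for S c
    proof
      assume "(S, c) [^]\<^bsub>?G\<^esub> (2::nat) = \<one>\<^bsub>?G\<^esub>"
      then have "(c + c) mod p = 0"
        unfolding even_shift_group_square[OF S c] even_shift_group_simps(3) by (rule Pair_inject)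
      then have "p dvd 2 * c"
        by (simp add: dvd_eq_mod_eq_0 mult_2)
      then have "p dvd c"
        using p(2) by (simp add: coprime_dvd_mult_right_iff)
      then show "c = 0"
        using c by (auto dest: dvd_imp_le)
    next
      assume "c = 0"
      moreover have "shift p 0 S = S"
        using S by (simp add: shift_0 even_sets_def)
      ultimately show "(S, c) [^]\<^bsub>?G\<^esub> (2::nat) = \<one>\<^bsub>?G\<^esub>"
        unfolding even_shift_group_square[OF S c] even_shift_group_simps(3) by simp
    qed
    then show ?thesis
      using p0 unfolding even_shift_group_simps(1) by blast
  qed
  have "x [^]\<^bsub>?G\<^esub> (2::nat) = \<one>\<^bsub>?G\<^esub> \<or> x [^]\<^bsub>?G\<^esub> p = \<one>\<^bsub>?G\<^esub>" if xG: "x \<in> carrier ?G" for x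
  proof -
    obtain S c where x: "x = (S, c)" "S \<in> even_sets p" "c < p"
      using xG by (auto simp: even_shift_group_simps)
    show ?thesis
    proof (cases "c = 0")
      case True
      then show ?thesis
        using involutions x by blast
    next
      case False
      then show ?thesis
        using even_shift_group_orders p x by blast
    qed
  qed
  then have "{g [^]\<^bsub>?G\<^esub> (2 ^ a :: nat) | g. g \<in> carrier ?G}
      = insert \<one>\<^bsub>?G\<^esub> (carrier ?G - even_sets p \<times> {0})"
    using G.power_image_eq_odd_part[OF p(2) a] involutions by simp
  moreover have "({}, 0) \<in> even_sets p \<times> {0}"
    by (simp add: even_sets_def)
  ultimately have "card {g [^]\<^bsub>?G\<^esub> (2 ^ a :: nat) | g. g \<in> carrier ?G}
      = Suc (card (even_sets p \<times> {..<p} - even_sets p \<times> {0}))"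
    by (simp add: even_shift_group_simps finite_even_sets)
  also have "card (even_sets p \<times> {..<p} - even_sets p \<times> {0}) = ?N * p - ?N"
    using p0 by (subst card_Diff_subset) (auto simp: finite_even_sets card_cartesian_product)
  finally have "image_ratio (2 ^ a) ?G = real (Suc (?N * p - ?N)) / real (?N * p)"
    by (simp add: image_ratio_def even_shift_group_simps card_cartesian_product)
  moreover have "?N > 0"
    by (auto simp: card_gt_0_iff finite_even_sets) (auto simp: even_sets_def)
  moreover have "?N \<le> ?N * p"
    using p0 by simp
  ultimately show ?thesis
    using p0 by (simp add: of_nat_diff field_simps)
qed

section \<open>Density\<close>

lemma image_ratio_near_one:
  fixes e :: real
  assumes "e > 0" and "a \<ge> 1"
  obtains r where "r \<in> image_ratios (2 ^ a)" and "1 - e < r" and "r < 1" and "0 \<le> r"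
proof -
  obtain n :: nat where n: "1 / e < real n"
    using reals_Archimedean2 by blast
  obtain p where p: "prime p" "p > max n 2"
    using bigger_prime by blast
  have "odd p"
    using p prime_odd_nat by auto
  let ?r = "image_ratio (2 ^ a) (even_shift_group p)" and ?N = "card (even_sets p)"
  have "finite (carrier (even_shift_group p))"
    by (simp add: even_shift_group_simps finite_even_sets)
  moreover have "group (even_shift_group p)"
    using p by (intro group_even_shift_group) simp
  ultimately have r: "?r \<in> image_ratios (2 ^ a)"
    by (intro image_ratio_in_image_ratios)
  \<comment> \<open>There is at least one involution, so the ratio is not \<open>1\<close>.\<close>
  have "{{}, {0, 1}} \<subseteq> even_sets p"
    using p by (auto simp: even_sets_def)
  then have "card {{}, {0, 1 :: nat}} \<le> ?N"
    by (intro card_mono finite_even_sets)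
  then have N: "?N \<ge> 2"
    by simp
  have "1 / e < real p"
    using n p by linarith
  then have "1 / real p < e"
    using assms(1) p by (simp add: field_simps)
  moreover have "0 < (1 - 1 / real ?N) / real p" "(1 - 1 / real ?N) / real p \<le> 1 / real p"
    using N p by (auto simp: divide_simps)
  ultimately have "1 - e < ?r" "?r < 1"
    using image_ratio_even_shift_group[OF p(1) \<open>odd p\<close> assms(2)] by linarith+
  moreover have "0 \<le> ?r"
    using r image_ratios_subset by fastforce
  ultimately show ?thesis
    using that r by blast
qed

lemma power_near:
  fixes r t e :: real
  assumes "0 \<le> r" and "r < 1" and "1 - e < r" and "0 \<le> t" and "t \<le> 1"
  obtains k :: nat where "\<bar>r ^ k - t\<bar> < e"
proof -
  have e: "0 < e"
    using assms by linarith
  have ex: "\<exists>k. r ^ k < t + e"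
    using real_arch_pow_inv[of "t + e" r] assms e by auto
  \<comment> \<open>The first power below \<open>t + e\<close> cannot already be below \<open>t - e\<close>, as a step down is at most
      \<open>1 - r < e\<close>.\<close>
  define k where "k = (LEAST k. r ^ k < t + e)"
  have k: "r ^ k < t + e"
    unfolding k_def using ex by (rule LeastI_ex)
  have "t - e < r ^ k"
  proof (cases k)
    case 0
    then show ?thesis
      using assms e by simp
  next
    case (Suc j)
    then have "\<not> r ^ j < t + e"
      unfolding k_def using not_less_Least by (metis lessI)
    moreover have "r ^ j * (1 - r) \<le> 1 * (1 - r)"
      using assms by (intro mult_right_mono power_le_one) simp_all
    ultimately show ?thesis
      using Suc assms by (simp add: algebra_simps)
  qed
  then show ?thesis
    using k by (intro that[of k]) linarith
qed

theorem theorem2p2: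
  fixes a M :: nat
  assumes "a \<ge> 1" and "M = 2 ^ a"
  shows "top_of_set {0..1} closure_of image_ratios M = {0..1}"
proof -
  have "t \<in> closure (image_ratios M)" if t: "0 \<le> t" "t \<le> 1" for t
    unfolding closure_approachable
  proof (intro allI impI)
    fix e :: real assume "0 < e"
    then obtain r where r: "r \<in> image_ratios M" "1 - e < r" "r < 1" "0 \<le> r"
      using image_ratio_near_one[of e a] assms by blast
    then obtain k :: nat where "\<bar>r ^ k - t\<bar> < e"
      using power_near t by blast
    then show "\<exists>y\<in>image_ratios M. dist y t < e"
      using image_ratios_power[OF r(1)] by (auto simp: dist_real_def)
  qed
  moreover have "{0..1} \<inter> image_ratios M = image_ratios M"
    using image_ratios_subset by blast
  ultimately show ?thesis
    by (auto simp: closure_of_subtopology)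
qed

end
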